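(* Let $X$ be an unbounded thin metric space (with integer valued metric) such that $|X|=\mathrm{asden}(X)=\varkappa$. Then the following statements hold: (i) if $\varkappa=\aleph_0$, then $X$ is coarsely equivalent either to $T(1,1,\dots)$ or to $T(\aleph_0,\aleph_0,\dots)$; (ii) if $\mathrm{cf}(\varkappa)>\aleph_0$, then $X$ is coarsely equivalent to $T(\varkappa,\varkappa,\dots)$; (iii) if $\varkappa>\aleph_0$, $\mathrm{cf}(\varkappa)=\aleph_0$ and $(\varkappa_n')_{n\in\mathbb{N}}$ is a sequence of cardinals such that $\varkappa_n'<\varkappa_{n+1}'$ for each $n\in\mathbb{N}$ and $\sup\{\varkappa_n':n\in\mathbb{N}\}=\varkappa$, then $X$ is coarsely equivalent either to $T(\varkappa_n')_{n\in\mathbb{N}}$ or to $T(\varkappa,\varkappa,\dots)$.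
   Context: All metrics are supposed to take values in $\omega=\{0,1,2,\dots\}$; $\mathbb{N}=\{1,2,\dots\}$. For a metric space $(X,d)$, $x\in X$, $m\in\omega$, $L\subseteq X$, put $B(x,m)=\{y\in X:d(x,y)\le m\}$ and $B(L,m)=\bigcup_{x\in L}B(x,m)$. A subset $V\subseteq X$ is bounded if $V\subseteq B(x_0,n)$ for some $x_0\in X$, $n\in\omega$. $X$ is thin if for every $m\in\omega$ there is a bounded subset $V$ of $X$ such that $B(x,m)=\{x\}$ for each $x\in X\setminus V$. A subset $L\subseteq X$ is large if $B(L,m)=X$ for some $m\in\omega$. The asymptotic density $\mathrm{asden}(X)$ is the minimal cardinality of a large subset of $X$. For metric spaces $(X_1,d_1)$, $(X_2,d_2)$, a bijection $f:X_1\to X_2$ is an asymorphism if there are sequences $(c_n)_{n\in\omega}$, $(c_n')_{n\in\omega}$ in $\omega$ such that for all $n\in\omega$ and $x,y\in X_1$: $d_1(x,y)\le n\Rightarrow d_2(f(x),f(y))<c_n$, and $d_2(f(x),f(y))\le n\Rightarrow d_1(x,y)<c_n'$. Two metric spaces $X_1,X_2$ are coarsely equivalent if there are large subsets $L_1\subseteq X_1$, $L_2\subseteq X_2$ which, with the restricted metrics, are asymorphic. The space $T(\varkappa_n)_{n\in\mathbb{N}}=T(\varkappa_1,\varkappa_2,\dots)$: for an infinite cardinal $\varkappa$ and a partition $\varkappa=\bigcup_{n\in\mathbb{N}}K_n$ into countably many pairwise disjoint subsets with $|K_n|=\varkappa_n$, it is the set $\varkappa$ with the metric $\rho(x,x)=0$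 and $\rho(x,y)=\max\{n,m\}$ if $x\in K_n$, $y\in K_m$, $x\ne y$. (Up to isometry it depends only on the sequence of cardinals $(\varkappa_n)$.) *)

theory Defs
  imports "HOL-Analysis.Analysis"
begin

unbundle cardinal_syntax

text \<open>
  Cardinals are represented as cardinal orders (\<^const>\<open>Card_order\<close>), compared by
  \<open>=o\<close>, \<open>\<le>o\<close>, \<open><o\<close>.  Every nonempty family of sets has a member of
  least cardinality, so the choice below is well defined up to \<open>=o\<close>.
\<close>

definition min_card :: "'a set set \<Rightarrow> 'a rel" where
  "min_card \<F> = |SOME A. A \<in> \<F> \<and> (\<forall>B\<in>\<F>. |A| \<le>o |B| )|"

lemma min_card_witness:
  assumes "\<F> \<noteq> {}"
  obtains A where "A \<in> \<F>" "min_card \<F> = |A|" "\<And>B. B \<in> \<F> \<Longrightarrow> |A| \<le>o |B|"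
proof -
  have "\<exists>r\<in>card_of ` \<F>. \<forall>r'\<in>card_of ` \<F>. r \<le>o r'"
    using assms by (intro exists_minim_Card_order) (auto simp: card_of_Card_order)
  then have ex: "\<exists>A. A \<in> \<F> \<and> (\<forall>B\<in>\<F>. |A| \<le>o |B| )"
    by auto
  show thesis
    using someI_ex[OF ex] by (intro that) (auto simp: min_card_def)
qed

text \<open>The library predicate \<^const>\<open>cofinal\<close> asks for strict upper bounds, which for
  infinite cardinals amounts to the usual notion.\<close>

definition cf :: "'a rel \<Rightarrow> 'a rel" where
  "cf r = min_card {A. A \<subseteq> Field r \<and> cofinal A r}"

text \<open>Upper bounds \<open>s\<close> are taken only over the type of \<open>r\<close>; this loses nothing, since
  every cardinal smaller than \<open>r\<close> is realised by a cardinal order on that type.\<close>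

definition is_card_Sup :: "(nat \<Rightarrow> 'c rel) \<Rightarrow> 'a rel \<Rightarrow> bool" where
  "is_card_Sup k r \<longleftrightarrow> Card_order r \<and> (\<forall>n\<ge>1. k n \<le>o r) \<and>
     (\<forall>s :: 'a rel. Card_order s \<and> (\<forall>n\<ge>1. k n \<le>o s) \<longrightarrow> r \<le>o s)"

definition (in Metric_space) thin :: bool where
  "thin \<longleftrightarrow> (\<forall>m::nat. \<exists>V. V \<subseteq> M \<and> mbounded V \<and> (\<forall>x \<in> M - V. mcball x (real m) = {x}))"

definition (in Metric_space) large :: "'a set \<Rightarrow> bool" where
  "large L \<longleftrightarrow> L \<subseteq> M \<and> (\<exists>m::nat. (\<Union>x\<in>L. mcball x (real m)) = M)"

definition (in Metric_space) asden :: "'a rel" where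
  "asden = min_card {L. large L}"

definition asymorphism ::
  "'a set \<Rightarrow> ('a \<Rightarrow> 'a \<Rightarrow> real) \<Rightarrow> 'b set \<Rightarrow> ('b \<Rightarrow> 'b \<Rightarrow> real) \<Rightarrow> ('a \<Rightarrow> 'b) \<Rightarrow> bool" where
  "asymorphism X\<^sub>1 d\<^sub>1 X\<^sub>2 d\<^sub>2 f \<longleftrightarrow> bij_betw f X\<^sub>1 X\<^sub>2 \<and>
     (\<exists>c c' :: nat \<Rightarrow> nat. \<forall>n. \<forall>x\<in>X\<^sub>1. \<forall>y\<in>X\<^sub>1.
        (d\<^sub>1 x y \<le> real n \<longrightarrow> d\<^sub>2 (f x) (f y) < real (c n)) \<and>
        (d\<^sub>2 (f x) (f y) \<le> real n \<longrightarrow> d\<^sub>1 x y < real (c' n)))"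

definition coarsely_equivalent ::
  "'a set \<Rightarrow> ('a \<Rightarrow> 'a \<Rightarrow> real) \<Rightarrow> 'b set \<Rightarrow> ('b \<Rightarrow> 'b \<Rightarrow> real) \<Rightarrow> bool" where
  "coarsely_equivalent X\<^sub>1 d\<^sub>1 X\<^sub>2 d\<^sub>2 \<longleftrightarrow>
     (\<exists>L\<^sub>1 L\<^sub>2 f. Metric_space.large X\<^sub>1 d\<^sub>1 L\<^sub>1 \<and> Metric_space.large X\<^sub>2 d\<^sub>2 L\<^sub>2 \<and>
        asymorphism L\<^sub>1 d\<^sub>1 L\<^sub>2 d\<^sub>2 f)"

text \<open>
  The underlying set is the disjoint union of the blocks \<open>K\<^sub>n = {n} \<times> Field (k n)\<close>, for
  \<open>n \<ge> 1\<close>, where the cardinal order \<open>k n\<close> stands for \<open>\<kappa>\<^sub>n\<close>.  The block index of a point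
  is its first component, so the metric itself does not mention \<open>k\<close>; the value \<open>k 0\<close> is
  irrelevant.  Lemma \<open>T_unique\<close> shows that every partitioned set with blocks of
  cardinality \<open>\<kappa>\<^sub>n\<close> is isometric to this model.
\<close>

definition T_space :: "(nat \<Rightarrow> 'c rel) \<Rightarrow> (nat \<times> 'c) set" where
  "T_space k = (SIGMA n:{1..}. Field (k n))"

definition T_dist :: "nat \<times> 'c \<Rightarrow> nat \<times> 'c \<Rightarrow> real" where
  "T_dist p q = (if p = q then 0 else real (max (fst p) (fst q)))"

lemma Metric_space_T: "Metric_space (T_space k) T_dist"
  by unfold_locales (auto simp: T_space_def T_dist_def max_def)

lemma T_dist_Nats: "T_dist p q \<in> \<nat>"
  by (auto simp: T_dist_def)

lemma T_unique:
  fixes K :: "nat \<Rightarrow> 'a set" and k :: "nat \<Rightarrow> 'c rel"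
  assumes disj: "disjoint_family_on K {1..}"
    and card: "\<And>n. n \<ge> 1 \<Longrightarrow> Card_order (k n) \<and> |K n| =o k n"
  shows "\<exists>f. bij_betw f (\<Union>n\<in>{1..}. K n) (T_space k) \<and>
           (\<forall>n\<ge>1. \<forall>m\<ge>1. \<forall>x\<in>K n. \<forall>y\<in>K m.
              T_dist (f x) (f y) = (if x = y then 0 else real (max n m)))"
proof -
  have "\<exists>g. bij_betw g (K n) (Field (k n))" if "n \<ge> 1" for n
  proof -
    have "|K n| =o |Field (k n)|"
      using card[OF that] card_of_Field_ordIso ordIso_symmetric ordIso_transitive by blast
    then show ?thesis
      using card_of_ordIso by blast
  qed
  then obtain g where g: "\<And>n. n \<ge> 1 \<Longrightarrow> bij_betw (g n) (K n) (Field (k n))"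
    by metis
  define i where "i x = (THE n. n \<ge> 1 \<and> x \<in> K n)" for x
  have i: "i x = n" if "n \<ge> 1" "x \<in> K n" for x n
    unfolding i_def using that disj
    by (intro the_equality) (auto simp: disjoint_family_on_def)
  define f where "f x = (i x, g (i x) x)" for x
  have inj: "inj_on f (\<Union>n\<in>{1..}. K n)"
  proof (rule inj_onI)
    fix x y assume "x \<in> (\<Union>n\<in>{1..}. K n)" "y \<in> (\<Union>n\<in>{1..}. K n)" and e: "f x = f y"
    then obtain n m where nm: "n \<ge> 1" "x \<in> K n" "m \<ge> 1" "y \<in> K m"
      by auto
    with e have "n = m" "g n x = g n y"
      by (auto simp: f_def i)
    with nm g[of n] show "x = y"
      by (auto simp: bij_betw_def dest: inj_onD)
  qed
  have im: "f ` (\<Union>n\<in>{1..}. K n) = T_space k"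
  proof
    show "f ` (\<Union>n\<in>{1..}. K n) \<subseteq> T_space k"
      using bij_betw_apply[OF g] by (auto simp: f_def i T_space_def)
    show "T_space k \<subseteq> f ` (\<Union>n\<in>{1..}. K n)"
    proof
      fix p assume "p \<in> T_space k"
      then obtain n z where p: "p = (n, z)" "n \<ge> 1" "z \<in> Field (k n)"
        by (auto simp: T_space_def)
      then obtain x where x: "x \<in> K n" "g n x = z"
        using bij_betw_imp_surj_on[OF g[of n]] by (metis imageE)
      then have "p = f x"
        using p by (simp add: f_def i)
      moreover have "x \<in> (\<Union>n\<in>{1..}. K n)"
        using x p by auto
      ultimately show "p \<in> f ` (\<Union>n\<in>{1..}. K n)"
        by (rule image_eqI)
    qed
  qed
  have "T_dist (f x) (f y) = (if x = y then 0 else real (max n m))"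
    if "n \<ge> 1" "m \<ge> 1" "x \<in> K n" "y \<in> K m" for n m x y
  proof -
    have "f x = f y \<longleftrightarrow> x = y"
      using inj_on_eq_iff[OF inj, of x y] that by auto
    moreover have "fst (f x) = n" "fst (f y) = m"
      using that by (auto simp: f_def i)
    ultimately show ?thesis
      by (simp add: T_dist_def)
  qed
  with inj im show ?thesis
    by (intro exI[of _ f]) (auto simp: bij_betw_def)
qed

end

theory Submission
  imports Defs
begin

text \<open>
  In an unbounded thin space with base point \<open>x\<^sub>0\<close>, two distinct points are close exactly when
  both are close to \<open>x\<^sub>0\<close>; so up to asymorphism only the height \<open>d x\<^sub>0 x\<close> matters.  An
  asymorphism between two such spaces is then a bijection controlling heights in both directions,
  and the Banach form of the Schroeder--Bernstein theorem assembles it from two height-controlling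
  injections.  Such an injection exists as soon as every ball of the source embeds into some annulus
  of the target with prescribed inner radius, which reduces everything to comparing cardinals.
  Either every ball of \<open>X\<close> has annuli of cardinality \<open>\<kappa>\<close> around it, or, after removing a ball,
  all balls have cardinality \<open>< \<kappa>\<close>; the hypothesis on \<open>asden\<close> ensures that the remaining set
  still has cardinality \<open>\<kappa>\<close>.  In the second case this set is the union of countably many
  balls, so \<open>\<kappa>\<close> has countable cofinality.
\<close>

section \<open>Metrics controlled by a height function\<close>

abbreviation sublevel :: "('a \<Rightarrow> nat) \<Rightarrow> 'a set \<Rightarrow> nat \<Rightarrow> 'a set" where
  "sublevel h A n \<equiv> {x \<in> A. h x \<le> n}"

abbreviation annulus :: "('a \<Rightarrow> nat) \<Rightarrow> 'a set \<Rightarrow> nat \<Rightarrow> nat \<Rightarrow> 'a set" where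
  "annulus h A j m \<equiv> {x \<in> A. j < h x \<and> h x \<le> m}"

text \<open>Records only which pairs are close, in a form shared by thin spaces and the spaces
  \<open>T\<close> and inherited by subsets. The condition \<open>x \<noteq> y\<close> matters: a
  point of any height is close to itself.\<close>

definition height_metric :: "'a set \<Rightarrow> ('a \<Rightarrow> 'a \<Rightarrow> real) \<Rightarrow> ('a \<Rightarrow> nat) \<Rightarrow> bool" where
  "height_metric A d h \<longleftrightarrow> (\<forall>x\<in>A. d x x = 0) \<and>
     (\<forall>n::nat. \<exists>r. \<forall>x\<in>A. \<forall>y\<in>A. x \<noteq> y \<and> d x y \<le> real n \<longrightarrow> h x \<le> r \<and> h y \<le> r) \<and>
     (\<forall>r. \<exists>n::nat. \<forall>x\<in>A. \<forall>y\<in>A. h x \<le> r \<and> h y \<le> r \<longrightarrow> d x y \<le> real n)"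

lemma height_metric_subset: "height_metric A d h \<Longrightarrow> B \<subseteq> A \<Longrightarrow> height_metric B d h"
  unfolding height_metric_def by (meson subsetD)

lemma height_metric_T: "height_metric (T_space k) T_dist fst"
  unfolding height_metric_def
proof (intro conjI allI)
  show "\<exists>r. \<forall>x\<in>T_space k. \<forall>y\<in>T_space k. x \<noteq> y \<and> T_dist x y \<le> real n \<longrightarrow> fst x \<le> r \<and> fst y \<le> r" for n
    by (rule exI[of _ n]) (auto simp: T_dist_def)
  show "\<exists>n. \<forall>x\<in>T_space k. \<forall>y\<in>T_space k. fst x \<le> r \<and> fst y \<le> r \<longrightarrow> T_dist x y \<le> real n" for r
    by (rule exI[of _ r]) (auto simp: T_dist_def)
qed (auto simp: T_dist_def)

text \<open>Distinct points at distance at most \<open>n\<close> lie in one sublevel of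
  \<open>h\<close>. Finitely many values of \<open>\<phi>\<close> bound the heights of their images,
  and distances in \<open>C\<close> are bounded at bounded height.\<close>

lemma height_controlled_bound:
  assumes A: "height_metric A d h" and C: "height_metric C e g" and inj: "inj_on f A"
    and sub: "f ` A \<subseteq> C" and bound: "\<And>x. x \<in> A \<Longrightarrow> g (f x) \<le> \<phi> (h x)"
  shows "\<exists>c::nat. \<forall>x\<in>A. \<forall>y\<in>A. d x y \<le> real n \<longrightarrow> e (f x) (f y) < real c"
proof -
  obtain r where r: "\<forall>x\<in>A. \<forall>y\<in>A. x \<noteq> y \<and> d x y \<le> real n \<longrightarrow> h x \<le> r \<and> h y \<le> r"
    using A unfolding height_metric_def by meson
  obtain c :: nat where
    c: "\<forall>x\<in>C. \<forall>y\<in>C. g x \<le> Max (\<phi> ` {..r}) \<and> g y \<le> Max (\<phi> ` {..r}) \<longrightarrow> e x y \<le> real c"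
    using C unfolding height_metric_def by meson
  have z: "\<forall>x\<in>C. e x x = 0"
    using C unfolding height_metric_def by blast
  have le: "g (f x) \<le> Max (\<phi> ` {..r})" if "x \<in> A" "h x \<le> r" for x
  proof -
    have "\<phi> (h x) \<le> Max (\<phi> ` {..r})"
      using that by (intro Max_ge) auto
    then show ?thesis
      using bound[OF that(1)] by linarith
  qed
  \<comment> \<open>\<open>Suc c\<close> makes the bound strict, and positive for the case
    \<open>x = y\<close>, where no height bound is available.\<close>
  have "e (f x) (f y) < real (Suc c)" if "x \<in> A" "y \<in> A" "d x y \<le> real n" for x y
  proof (cases "x = y")
    case True
    then show ?thesis
      using z sub that by auto
  next
    case False
    then have "h x \<le> r" "h y \<le> r"
      using r that by blast+
    then have "e (f x) (f y) \<le> real c"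
      using c le that sub by blast
    then show ?thesis
      by simp
  qed
  then show ?thesis
    by blast
qed

lemma asymorphism_heightI:
  assumes A: "height_metric A d h" and C: "height_metric C e g" and bij: "bij_betw f A C"
    and fwd: "\<And>x. x \<in> A \<Longrightarrow> g (f x) \<le> \<phi> (h x)" and bwd: "\<And>x. x \<in> A \<Longrightarrow> h x \<le> \<psi> (g (f x))"
  shows "asymorphism A d C e f"
proof -
  let ?f' = "the_inv_into A f"
  have inj: "inj_on f A" and im: "f ` A = C"
    using bij by (auto simp: bij_betw_def)
  have inv: "?f' (f x) = x" if "x \<in> A" for x
    using inj that by (rule the_inv_into_f_f)
  have "\<exists>c::nat. \<forall>x\<in>A. \<forall>y\<in>A. d x y \<le> real n \<longrightarrow> e (f x) (f y) < real c" for n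
    using height_controlled_bound[OF A C inj] im fwd by blast
  moreover have "\<exists>c::nat. \<forall>x\<in>C. \<forall>y\<in>C. e x y \<le> real n \<longrightarrow> d (?f' x) (?f' y) < real c" for n
    using height_controlled_bound[OF C A, of ?f' \<psi> n] im inv bwd inj_on_the_inv_into[OF inj]
    by fastforce
  then have "\<exists>c::nat. \<forall>x\<in>A. \<forall>y\<in>A. e (f x) (f y) \<le> real n \<longrightarrow> d x y < real c" for n
    using im inv by (metis imageI)
  ultimately show ?thesis
    unfolding asymorphism_def using bij by metis
qed

section \<open>Height-controlling injections and bijections\<close>

text \<open>The last conjunct says that each value stems from one of the two injections, so height
  bounds for both pass to \<open>F\<close>.\<close>

lemma Banach_bijection:
  assumes f: "inj_on f A" "f ` A \<subseteq> C" and g: "inj_on g C" "g ` C \<subseteq> A"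
  shows "\<exists>F. bij_betw F A C \<and> (\<forall>x\<in>A. F x = f x \<or> g (F x) = x)"
proof -
  \<comment> \<open>At the fixed point, \<open>A - S\<close> is exactly the \<open>g\<close>-image
    of what \<open>f\<close> on \<open>S\<close> misses in \<open>C\<close>; hence \<open>f\<close>
    on \<open>S\<close> and the inverse of \<open>g\<close> on \<open>A - S\<close> fit
    together.\<close>
  define S where "S = lfp (\<lambda>S. A - g ` (C - f ` S))"
  have "mono (\<lambda>S. A - g ` (C - f ` S))"
    by (rule monoI) blast
  then have S: "S = A - g ` (C - f ` S)"
    unfolding S_def by (rule lfp_unfold)
  then have SA: "S \<subseteq> A" and AS: "A - S = g ` (C - f ` S)"
    using g(2) by blast+
  define F where "F x = (if x \<in> S then f x else the_inv_into C g x)" for x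
  have gF: "g (F x) = x" "F x \<in> C - f ` S" if "x \<in> A - S" for x
  proof -
    obtain y where y: "y \<in> C - f ` S" "x = g y"
      using \<open>x \<in> A - S\<close> AS by blast
    then have "F x = y"
      using \<open>x \<in> A - S\<close> g(1) by (simp add: F_def the_inv_into_f_f)
    then show "g (F x) = x" "F x \<in> C - f ` S"
      using y by auto
  qed
  have FS: "F x = f x" if "x \<in> S" for x
    using that by (simp add: F_def)
  have "inj_on F A"
  proof (rule inj_onI)
    fix x y assume xy: "x \<in> A" "y \<in> A" "F x = F y"
    show "x = y"
    proof (cases "x \<in> S \<longleftrightarrow> y \<in> S")
      case True
      then show ?thesis
        using xy gF(1) FS inj_onD[OF f(1)] by (metis DiffI)
    next
      case False
      then show ?thesis
        using xy gF(2) FS by (metis DiffE DiffI imageI)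
    qed
  qed
  moreover have "F ` A = C"
  proof
    show "F ` A \<subseteq> C"
      using gF FS f(2) by blast
    show "C \<subseteq> F ` A"
    proof
      fix y assume y: "y \<in> C"
      show "y \<in> F ` A"
      proof (cases "y \<in> f ` S")
        case True
        then show ?thesis
          using FS SA by force
      next
        case False
        then have "g y \<in> A - S"
          using AS y by blast
        then have "F (g y) = y"
          using gF[of "g y"] y inj_onD[OF g(1), of "F (g y)" y] by simp
        then show ?thesis
          using \<open>g y \<in> A - S\<close> by (metis DiffD1 imageI)
      qed
    qed
  qed
  ultimately show ?thesis
    using gF FS by (intro exI[of _ F]) (auto simp: bij_betw_def)
qed

text \<open>The inner radius \<open>j\<close> is prescribed and the outer one free, so that
  successive levels of \<open>A\<close> can be placed in disjoint annuli of
  \<open>C\<close>.\<close>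

definition annulus_dominated ::
  "('a \<Rightarrow> nat) \<Rightarrow> 'a set \<Rightarrow> ('b \<Rightarrow> nat) \<Rightarrow> 'b set \<Rightarrow> bool" where
  "annulus_dominated h A g C \<longleftrightarrow> (\<forall>n j. \<exists>m. |sublevel h A n| \<le>o |annulus g C j m| )"

text \<open>Points of height \<open>n\<close> go to the annulus from \<open>\<mu> n\<close> to
  \<open>\<mu> (Suc n)\<close>. Disjointness of these annuli gives injectivity, and
  \<open>n \<le> \<mu> n\<close> the lower bound on heights.\<close>

lemma annulus_dominated_injection:
  assumes "annulus_dominated h A g C"
  obtains f \<phi> where "inj_on f A" "f ` A \<subseteq> C"
    "\<And>x. x \<in> A \<Longrightarrow> h x \<le> g (f x)" "\<And>x. x \<in> A \<Longrightarrow> g (f x) \<le> \<phi> (h x)"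
proof -
  define M where "M n j = (SOME m. |sublevel h A n| \<le>o |annulus g C j m| )" for n j
  have "\<exists>m. |sublevel h A n| \<le>o |annulus g C j m|" for n j
    using assms unfolding annulus_dominated_def by blast
  then have M: "|sublevel h A n| \<le>o |annulus g C j (M n j)|" for n j
    unfolding M_def by (rule someI_ex)
  \<comment> \<open>The outer radius for one level is the inner radius for the next;
    \<open>Suc j\<close> forces strict growth.\<close>
  define \<mu> where "\<mu> = rec_nat 0 (\<lambda>n j. max (M n j) (Suc j))"
  have Suc: "\<mu> (Suc n) = max (M n (\<mu> n)) (Suc (\<mu> n))" for n
    by (simp add: \<mu>_def)
  have sm: "strict_mono \<mu>"
    by (auto simp: strict_mono_Suc_iff Suc less_max_iff_disj)
  have "\<forall>n. \<exists>u. inj_on u (sublevel h A n) \<and>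
      u ` sublevel h A n \<subseteq> annulus g C (\<mu> n) (\<mu> (Suc n))"
  proof
    fix n
    have "annulus g C (\<mu> n) (M n (\<mu> n)) \<subseteq> annulus g C (\<mu> n) (\<mu> (Suc n))"
      by (auto simp: Suc)
    then have "|sublevel h A n| \<le>o |annulus g C (\<mu> n) (\<mu> (Suc n))|"
      using M card_of_mono1 ordLeq_transitive by blast
    then show "\<exists>u. inj_on u (sublevel h A n) \<and>
        u ` sublevel h A n \<subseteq> annulus g C (\<mu> n) (\<mu> (Suc n))"
      by (rule card_of_ordLeq[THEN iffD2])
  qed
  from choice[OF this] obtain u where u: "\<And>n. inj_on (u n) (sublevel h A n)"
      "\<And>n. u n ` sublevel h A n \<subseteq> annulus g C (\<mu> n) (\<mu> (Suc n))"
    by blast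
  define f where "f x = u (h x) x" for x
  have f: "f x \<in> C" "\<mu> (h x) < g (f x)" "g (f x) \<le> \<mu> (Suc (h x))" if "x \<in> A" for x
    using u(2)[of "h x"] that unfolding f_def by auto
  have less: "f x \<noteq> f y" if "x \<in> A" "y \<in> A" "h x < h y" for x y
  proof -
    have "\<mu> (Suc (h x)) \<le> \<mu> (h y)"
      using sm that by (simp add: strict_mono_less_eq)
    then show ?thesis
      using f(3)[OF that(1)] f(2)[OF that(2)] by auto
  qed
  have "inj_on f A"
  proof (rule inj_onI)
    fix x y assume xy: "x \<in> A" "y \<in> A" "f x = f y"
    then have "h x = h y"
      using less by (metis linorder_neqE_nat)
    then show "x = y"
      using inj_onD[OF u(1)[of "h x"], of x y] xy by (simp add: f_def)
  qed
  moreover have "h x \<le> g (f x)" if "x \<in> A" for x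
    using f(2)[OF that] strict_mono_imp_increasing[OF sm, of "h x"] by linarith
  ultimately show thesis
    using f that[of f "\<lambda>n. \<mu> (Suc n)"] by blast
qed

lemma asymorphism_if_annulus_dominated:
  assumes A: "height_metric A d h" and C: "height_metric C e g"
    and AC: "annulus_dominated h A g C" and CA: "annulus_dominated g C h A"
  shows "\<exists>f. asymorphism A d C e f"
proof -
  obtain f \<phi> where f: "inj_on f A" "f ` A \<subseteq> C"
    "\<And>x. x \<in> A \<Longrightarrow> h x \<le> g (f x)" "\<And>x. x \<in> A \<Longrightarrow> g (f x) \<le> \<phi> (h x)"
    using annulus_dominated_injection[OF AC] by metis
  obtain f' \<psi> where f': "inj_on f' C" "f' ` C \<subseteq> A"
    "\<And>y. y \<in> C \<Longrightarrow> g y \<le> h (f' y)" "\<And>y. y \<in> C \<Longrightarrow> h (f' y) \<le> \<psi> (g y)"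
    using annulus_dominated_injection[OF CA] by metis
  obtain F where F: "bij_betw F A C" "\<And>x. x \<in> A \<Longrightarrow> F x = f x \<or> f' (F x) = x"
    using Banach_bijection[OF f(1,2) f'(1,2)] by blast
  \<comment> \<open>Each alternative for \<open>F x\<close> gives one direct comparison of the
    heights and one through \<open>\<phi>\<close> or \<open>\<psi>\<close>; the sums cover both
    alternatives.\<close>
  have "g (F x) \<le> h x + \<phi> (h x) \<and> h x \<le> g (F x) + \<psi> (g (F x))" if "x \<in> A" for x
  proof -
    have "F x \<in> C"
      using F(1) that by (rule bij_betw_apply)
    then show ?thesis
      using F(2)[OF that] f(3,4)[OF that] f'(3,4)[of "F x"] by auto
  qed
  then show ?thesis
    using asymorphism_heightI[OF A C F(1), of "\<lambda>n. n + \<phi> n" "\<lambda>n. n + \<psi> n"] by blast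
qed

section \<open>Cardinalities of sublevel sets and annuli\<close>

lemma card_of_not_ordLeq_iff: "\<not> |A| \<le>o |B| \<longleftrightarrow> |B| <o |A|"
  by (rule not_ordLeq_iff_ordLess[OF card_of_Well_order card_of_Well_order])

lemma card_of_finite_ordLess: "finite A \<Longrightarrow> infinite B \<Longrightarrow> |A| <o |B|"
  by (rule finite_ordLess_infinite[OF card_of_Well_order card_of_Well_order])
    (simp_all add: Field_card_of)

lemma annulus_dominated_full:
  assumes "\<And>j. \<exists>m. |A| \<le>o |annulus g C j m|"
  shows "annulus_dominated h A g C"
  unfolding annulus_dominated_def
proof (intro allI)
  fix n j
  obtain m where "|A| \<le>o |annulus g C j m|"
    using assms by blast
  moreover have "|sublevel h A n| \<le>o |A|"
    by (rule card_of_mono1) auto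
  ultimately show "\<exists>m. |sublevel h A n| \<le>o |annulus g C j m|"
    using ordLeq_transitive by blast
qed

text \<open>Outside a sublevel, \<open>C\<close> keeps its full cardinality and is a countable union
  of annuli. If all were at most as large as an infinite sublevel of \<open>A\<close>, so would be
  \<open>C\<close>. Finite sublevels are treated separately, since the union bound needs an infinite
  cardinal.\<close>

lemma annulus_dominated_small:
  assumes inf: "infinite C" and A: "\<And>n. |sublevel h A n| <o |C|"
    and C: "\<And>n. |sublevel g C n| <o |C|"
  shows "annulus_dominated h A g C"
  unfolding annulus_dominated_def
proof (intro allI)
  fix n j
  let ?A = "sublevel h A n" and ?D = "\<Union>m. annulus g C j m"
  have D: "?D = {y \<in> C. j < g y}"
    by auto
  have "C = sublevel g C j \<union> ?D"
    by auto
  then have "\<not> |?D| <o |C|"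
    using card_of_Un_ordLess_infinite[OF inf C[of j], of ?D] ordLess_irreflexive[of "|C|"] by metis
  then have CD: "|C| \<le>o |?D|"
    using card_of_not_ordLeq_iff by blast
  show "\<exists>m. |?A| \<le>o |annulus g C j m|"
  proof (cases "finite ?A")
    case True
    have "infinite ?D"
      using inf CD card_of_ordLeq_infinite by blast
    then obtain F where F: "F \<subseteq> ?D" "finite F" "card F = card ?A"
      using infinite_arbitrarily_large by blast
    have "F \<subseteq> annulus g C j (Max (g ` F))"
      using F(1,2) D by auto
    then have "|F| \<le>o |annulus g C j (Max (g ` F))|"
      by (rule card_of_mono1)
    moreover have "|?A| =o |F|"
      using F(2,3) True by (metis card_of_ordIso finite_same_card_bij)
    ultimately show ?thesis
      using ordIso_ordLeq_trans by blast
  next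
    case False
    show ?thesis
    proof (rule ccontr)
      assume "\<not> ?thesis"
      then have "\<forall>m\<in>UNIV. |annulus g C j m| \<le>o |?A|"
        by (simp add: card_of_not_ordLeq_iff ordLess_imp_ordLeq)
      moreover have "|UNIV :: nat set| \<le>o |?A|"
        using False infinite_iff_card_of_nat by blast
      ultimately have "|?D| \<le>o |?A|"
        using False by (intro card_of_UNION_ordLeq_infinite) auto
      with CD have "|C| \<le>o |?A|"
        using ordLeq_transitive by blast
      then show False
        using A[of n] not_ordLess_ordLeq by blast
    qed
  qed
qed

text \<open>With uncountable cofinality, the countably many cardinals of the sublevels would have a
  common bound below \<open>|X|\<close>, and so would their union \<open>L\<close>.\<close>

lemma not_uncountable_cf_if_sublevels_less:
  fixes L :: "'b set" and X :: "'a set"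
  assumes inf: "infinite X" and L: "|X| \<le>o |L|" and less: "\<And>n. |sublevel h L n| <o |X|"
  shows "\<not> natLeq <o cf |X|"
proof
  assume cf: "natLeq <o cf |X|"
  have cf_le: "cf |X| \<le>o |A|" if "A \<subseteq> X" "cofinal A |X|" for A
  proof -
    let ?F = "{A. A \<subseteq> Field |X| \<and> cofinal A |X| }"
    have A: "A \<in> ?F"
      using that by (simp add: Field_card_of)
    then have "?F \<noteq> {}"
      by blast
    then obtain B where "cf |X| = |B|" "\<forall>D\<in>?F. |B| \<le>o |D|"
      unfolding cf_def by (metis (no_types, lifting) min_card_witness)
    then show ?thesis
      using A by simp
  qed
  \<comment> \<open>Since \<open>X\<close> is cofinal in itself, uncountable cofinality makes
    \<open>X\<close> uncountable.\<close>
  have "cofinal X |X|"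
    unfolding cofinal_def
    using infinite_Card_order_limit[of "|X|"] inf by (metis Field_card_of card_of_Card_order)
  then have nX: "natLeq <o |X|"
    using cf cf_le ordLess_ordLeq_trans by blast
  have "\<forall>n. \<exists>a. a \<in> X \<and> |sublevel h L n| =o Restr |X| (underS |X| a)"
  proof
    fix n
    show "\<exists>a. a \<in> X \<and> |sublevel h L n| =o Restr |X| (underS |X| a)"
      using ordLess_iff_ordIso_Restr[OF card_of_Well_order card_of_Well_order, THEN iffD1, OF less]
      by (auto simp: Field_card_of)
  qed
  from choice[OF this] obtain a where
    a: "\<And>n. a n \<in> X" "\<And>n. |sublevel h L n| =o Restr |X| (underS |X| (a n))"
    by blast
  have ub: "|sublevel h L n| \<le>o |underS |X| (a n)|" for n
  proof -
    have "Field (Restr |X| (underS |X| (a n))) \<subseteq> underS |X| (a n)"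
      by (auto simp: Field_def)
    then have "|Field (Restr |X| (underS |X| (a n)))| \<le>o |underS |X| (a n)|"
      by (rule card_of_mono1)
    with card_of_cong[OF a(2)[of n]] show ?thesis
      unfolding Field_card_of by (rule ordIso_ordLeq_trans)
  qed
  have "|range a| \<le>o |UNIV :: nat set|"
    by (rule card_of_image)
  from ordLeq_ordIso_trans[OF this card_of_nat] have "\<not> cofinal (range a) |X|"
    using cf cf_le[of "range a"] a(1) not_ordLess_ordLeq ordLeq_transitive image_subsetI by metis
  \<comment> \<open>Negating the strict \<open>cofinal\<close> leaves a weak upper bound
    \<open>b\<close> of all \<open>a n\<close>, by linearity of the order.\<close>
  then obtain b where b: "b \<in> X" "\<And>n. b = a n \<or> (b, a n) \<notin> |X|"
    unfolding cofinal_def Field_card_of by blast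
  have lin: "Linear_order |X|"
    using card_of_Well_order[of X] unfolding well_order_on_def by (rule conjunct1)
  then have ab: "(a n, b) \<in> |X|" for n
    using b(1) b(2)[of n] a(1)[of n]
    unfolding linear_order_on_def partial_order_on_def preorder_on_def refl_on_def total_on_def
      Field_card_of by metis
  obtain c where c: "c \<in> X" "b \<noteq> c" "(b, c) \<in> |X|"
    using infinite_Card_order_limit[of "|X|" b] inf b(1) by (metis Field_card_of card_of_Card_order)
  have "underS |X| (a n) \<subseteq> underS |X| c" for n
    using lin ab[of n] c unfolding underS_def linear_order_on_def partial_order_on_def
      preorder_on_def trans_def antisym_def by blast
  then have le: "|sublevel h L n| \<le>o |underS |X| c|" for n
    by (rule ordLeq_transitive[OF ub card_of_mono1])
  have cX: "|underS |X| c| <o |X|"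
    using c(1) by (intro card_of_underS card_of_Card_order) (simp add: Field_card_of)
  \<comment> \<open>The copy of the naturals makes the bound infinite and absorbs the countable
    index set, while \<open>?B\<close> stays below the uncountable \<open>|X|\<close>.\<close>
  let ?B = "underS |X| c <+> (UNIV :: nat set)"
  have "|UNIV :: nat set| <o |X|"
    by (rule ordIso_ordLess_trans[OF card_of_nat nX])
  then have BX: "|?B| <o |X|"
    by (rule card_of_Plus_ordLess_infinite[OF inf cX])
  have "|\<Union>n. sublevel h L n| \<le>o |?B|"
  proof (rule card_of_UNION_ordLeq_infinite)
    show "infinite ?B"
      by simp
    show "|UNIV :: nat set| \<le>o |?B|"
      by (rule card_of_Plus2)
    show "\<forall>n\<in>UNIV. |sublevel h L n| \<le>o |?B|"
      using ordLeq_transitive[OF le card_of_Plus1] by blast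
  qed
  moreover have "(\<Union>n. sublevel h L n) = L"
    by auto
  ultimately have "|X| \<le>o |?B|"
    using ordLeq_transitive[OF L] by metis
  then show False
    using not_ordLess_ordLeq[OF BX] by blast
qed

section \<open>Thin metric spaces\<close>

context Metric_space
begin

lemma large_self: "large M"
  unfolding large_def by (intro conjI exI[of _ 0]) auto

text \<open>Two distinct points at distance at most \<open>n\<close> both have a nontrivial ball of
  radius \<open>n\<close>, so both lie in the bounded exceptional set for that radius.\<close>

lemma thin_height_metric:
  assumes "thin" "z \<in> M"
  shows "height_metric M d (\<lambda>x. nat \<lceil>d z x\<rceil>)"
proof -
  have "\<exists>r. \<forall>x\<in>M. \<forall>y\<in>M. x \<noteq> y \<and> d x y \<le> real n \<longrightarrow> nat \<lceil>d z x\<rceil> \<le> r \<and> nat \<lceil>d z y\<rceil> \<le> r" for n :: nat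
  proof -
    obtain V where V: "mbounded V" "\<And>x. x \<in> M - V \<Longrightarrow> mcball x (real n) = {x}"
      using assms(1) unfolding thin_def by metis
    \<comment> \<open>With \<open>z\<close> included, a bound on pairwise distances bounds the
      distances from \<open>z\<close>.\<close>
    have "mbounded (insert z V)"
      using V(1) assms(2) by (simp add: mbounded_insert)
    then obtain B where B: "\<And>x. x \<in> V \<Longrightarrow> d z x \<le> B"
      unfolding mbounded_alt by blast
    have "x \<in> V" if "x \<in> M" "y \<in> M" "x \<noteq> y" "d x y \<le> real n" for x y
    proof (rule ccontr)
      assume "x \<notin> V"
      then have "mcball x (real n) = {x}"
        using V(2) that by blast
      moreover have "y \<in> mcball x (real n)"
        using that by simp
      ultimately show False
        using that by simp
    qed
    then have "d z x \<le> B \<and> d z y \<le> B" if "x \<in> M" "y \<in> M" "x \<noteq> y" "d x y \<le> real n" for x y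
      using B that commute by metis
    then show ?thesis
      by (intro exI[of _ "nat \<lceil>B\<rceil>"]) (metis ceiling_mono nat_mono)
  qed
  then have near: "\<forall>n::nat. \<exists>r. \<forall>x\<in>M. \<forall>y\<in>M. x \<noteq> y \<and> d x y \<le> real n \<longrightarrow>
      nat \<lceil>d z x\<rceil> \<le> r \<and> nat \<lceil>d z y\<rceil> \<le> r"
    by (rule allI)
  have "d x y \<le> real (2 * r)"
    if "x \<in> M" "y \<in> M" "nat \<lceil>d z x\<rceil> \<le> r" "nat \<lceil>d z y\<rceil> \<le> r" for r x y
  proof -
    have "d z x \<le> real r" "d z y \<le> real r"
      using that by linarith+
    then show ?thesis
      using triangle[of x z y] that assms(2) commute[of x z] by simp
  qed
  then have "\<exists>n::nat. \<forall>x\<in>M. \<forall>y\<in>M. nat \<lceil>d z x\<rceil> \<le> r \<and> nat \<lceil>d z y\<rceil> \<le> r \<longrightarrow> d x y \<le> real n" for r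
    by (intro exI[of _ "2 * r"]) blast
  with near show ?thesis
    unfolding height_metric_def by (intro conjI allI ballI) simp_all
qed

text \<open>The ball of radius \<open>j\<close> around \<open>z\<close> recovers all discarded
  points.\<close>

lemma large_insert_far:
  assumes "z \<in> M"
  shows "large (insert z {x \<in> M. j < nat \<lceil>d z x\<rceil>})"
  unfolding large_def
proof (intro conjI exI)
  show "(\<Union>x\<in>insert z {x \<in> M. j < nat \<lceil>d z x\<rceil>}. mcball x (real j)) = M"
  proof (intro subset_antisym subsetI)
    fix y assume y: "y \<in> M"
    show "y \<in> (\<Union>x\<in>insert z {x \<in> M. j < nat \<lceil>d z x\<rceil>}. mcball x (real j))"
    proof (cases "j < nat \<lceil>d z y\<rceil>")
      case True
      then have "y \<in> mcball y (real j)"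
        using y by simp
      then show ?thesis
        using True y by blast
    next
      case False
      then have "d z y \<le> real j"
        by linarith
      then show ?thesis
        using y assms by simp
    qed
  qed auto
qed (use assms in auto)

lemma asden_le:
  assumes "large L"
  shows "asden \<le>o |L|"
proof -
  have ne: "{L. large L} \<noteq> {}"
    using assms by blast
  obtain A where "asden = |A|" "\<forall>B\<in>{L. large L}. |A| \<le>o |B|"
    unfolding asden_def by (metis (no_types, lifting) ne min_card_witness)
  then show ?thesis
    using assms by simp
qed

lemma infinite_if_unbounded: "\<not> mbounded M \<Longrightarrow> infinite M"
proof
  assume unb: "\<not> mbounded M" and "finite M"
  have "mbounded S" if "finite S" "S \<subseteq> M" for S
    using that by (induction rule: finite_induct) (auto simp: mbounded_insert)
  then show False
    using unb \<open>finite M\<close> by blast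
qed

lemma thin_cases:
  assumes unb: "\<not> mbounded M" and "thin" and asden: "asden =o |M|"
  obtains (full) h where "height_metric M d h" "\<And>j. \<exists>m. |M| \<le>o |annulus h M j m|"
  | (small) h L where "large L" "height_metric L d h" "|L| =o |M|" "\<And>n. |sublevel h L n| <o |M|"
proof -
  obtain z where z: "z \<in> M"
    using unb mbounded_empty by (metis all_not_in_conv)
  have inf: "infinite M"
    using unb by (rule infinite_if_unbounded)
  define h where "h x = nat \<lceil>d z x\<rceil>" for x
  have h: "height_metric M d h"
    unfolding h_def using thin_height_metric \<open>thin\<close> z by blast
  show thesis
  proof (cases "\<forall>j. \<exists>m. |M| \<le>o |annulus h M j m|")
    case True
    then show thesis
      using full h by blast
  next
    case False
    then obtain j where "\<forall>m. \<not> |M| \<le>o |annulus h M j m|"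
      by blast
    then have j: "|annulus h M j m| <o |M|" for m
      unfolding card_of_not_ordLeq_iff by blast
    let ?L = "insert z {x \<in> M. j < h x}"
    have large: "large ?L"
      unfolding h_def using large_insert_far z by blast
    have LM: "?L \<subseteq> M"
      using z by auto
    \<comment> \<open>The density hypothesis enters here: a large set cannot have smaller
      cardinality.\<close>
    have "|M| \<le>o |?L|"
      by (rule ordIso_ordLeq_trans[OF ordIso_symmetric[OF asden] asden_le[OF large]])
    then have "|?L| =o |M|"
      using card_of_mono1[OF LM] by (simp add: ordIso_iff_ordLeq)
    moreover have "|sublevel h ?L n| <o |M|" for n
    proof -
      have "|{z}| <o |M|"
        using inf by (intro card_of_finite_ordLess) auto
      then have "|{z} \<union> annulus h M j n| <o |M|"
        using j by (rule card_of_Un_ordLess_infinite[OF inf])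
      moreover have "|sublevel h ?L n| \<le>o |{z} \<union> annulus h M j n|"
        by (rule card_of_mono1) auto
      ultimately show ?thesis
        by (blast intro: ordLeq_ordLess_trans)
    qed
    ultimately show thesis
      using small large height_metric_subset[OF h LM] by blast
  qed
qed

lemma coarsely_equivalent_T:
  assumes "large L" "height_metric L d h"
    and "annulus_dominated h L fst (T_space k)" "annulus_dominated fst (T_space k) h L"
  shows "coarsely_equivalent M d (T_space k) T_dist"
  using assms(1) asymorphism_if_annulus_dominated[OF assms(2) height_metric_T assms(3,4)]
    Metric_space.large_self[OF Metric_space_T] unfolding coarsely_equivalent_def by blast

end

section \<open>The spaces \<open>T\<close>\<close>

lemma card_of_T_block:
  fixes r :: "'b rel"
  assumes "Card_order r"
  shows "|{n} \<times> Field r| =o r"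
proof -
  have "bij_betw snd ({n} \<times> Field r) (Field r)"
    by (auto simp: bij_betw_def inj_on_def)
  then have "|{n} \<times> Field r| =o |Field r|"
    by (rule card_of_ordIsoI)
  then show ?thesis
    using card_of_Field_ordIso[OF assms] ordIso_transitive by blast
qed

lemma card_of_T_le:
  assumes "infinite X" and "\<And>n. n \<ge> 1 \<Longrightarrow> Card_order (k n)" and "\<And>n. n \<ge> 1 \<Longrightarrow> k n \<le>o |X|"
  shows "|T_space k| \<le>o |X|"
proof -
  have "T_space k = (\<Union>n\<in>{1..}. {n} \<times> Field (k n))"
    by (auto simp: T_space_def)
  moreover have "|{1::nat..}| \<le>o |X|"
    using card_of_mono1[of "{1::nat..}" UNIV] assms(1) infinite_iff_card_of_nat ordLeq_transitive
    by blast
  moreover have "\<forall>n\<in>{1..}. |{n} \<times> Field (k n)| \<le>o |X|"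
    using card_of_T_block assms(2,3) ordIso_ordLeq_trans by fastforce
  ultimately show ?thesis
    using card_of_UNION_ordLeq_infinite[OF assms(1), of "{1..}" "\<lambda>n. {n} \<times> Field (k n)"] by simp
qed

text \<open>A sublevel is a finite union of blocks, so it stays below \<open>|X|\<close> even if
  that cardinal is singular.\<close>

lemma card_of_T_sublevel_less:
  assumes "infinite X" and "\<And>n. n \<ge> 1 \<Longrightarrow> Card_order (k n)" and "\<And>n. n \<ge> 1 \<Longrightarrow> k n <o |X|"
  shows "|sublevel fst (T_space k) n| <o |X|"
proof (induction n)
  case 0
  have "sublevel fst (T_space k) 0 = {}"
    by (auto simp: T_space_def)
  moreover have "|{} :: (nat \<times> 'b) set| <o |X|"
    using assms(1) by (intro card_of_finite_ordLess) auto
  ultimately show ?case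
    by (simp only:)
next
  case (Suc n)
  have "|{Suc n} \<times> Field (k (Suc n))| <o |X|"
    by (rule ordIso_ordLess_trans[OF card_of_T_block[OF assms(2)] assms(3)]) simp_all
  with Suc have "|sublevel fst (T_space k) n \<union> {Suc n} \<times> Field (k (Suc n))| <o |X|"
    by (rule card_of_Un_ordLess_infinite[OF assms(1)])
  moreover have "sublevel fst (T_space k) (Suc n)
      = sublevel fst (T_space k) n \<union> {Suc n} \<times> Field (k (Suc n))"
    by (auto simp: T_space_def le_Suc_eq)
  ultimately show ?case
    by simp
qed

lemma card_of_T_const_annulus:
  assumes "Card_order r"
  shows "r \<le>o |annulus fst (T_space (\<lambda>_. r)) j (Suc j)|"
proof -
  have "{Suc j} \<times> Field r \<subseteq> annulus fst (T_space (\<lambda>_. r)) j (Suc j)"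
    by (auto simp: T_space_def)
  then have "|{Suc j} \<times> Field r| \<le>o |annulus fst (T_space (\<lambda>_. r)) j (Suc j)|"
    by (rule card_of_mono1)
  then show ?thesis
    by (rule ordIso_ordLeq_trans[OF ordIso_symmetric[OF card_of_T_block[OF assms]]])
qed

lemma card_of_T_ge_Sup:
  fixes X :: "'a set" and k :: "nat \<Rightarrow> 'c rel"
  assumes k: "\<And>n. n \<ge> 1 \<Longrightarrow> Card_order (k n)" and sup: "is_card_Sup k |X|"
  shows "|X| \<le>o |T_space k|"
proof (rule ccontr)
  assume "\<not> |X| \<le>o |T_space k|"
  then have T: "|T_space k| <o |X|"
    unfolding card_of_not_ordLeq_iff .
  \<comment> \<open>\<open>is_card_Sup\<close> ranges over bounds on the type of \<open>X\<close>,
    so the cardinal of \<open>T_space k\<close> is first copied to a set \<open>S\<close> of that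
    type.\<close>
  then obtain S :: "'a set" where S: "|T_space k| =o |S|" "|S| <o |X|"
    using internalize_card_of_ordLess[of "T_space k" "|X|"] by blast
  have "k n \<le>o |S|" if "n \<ge> 1" for n
  proof -
    have "|{n} \<times> Field (k n)| \<le>o |T_space k|"
      using that by (intro card_of_mono1) (auto simp: T_space_def)
    from ordLeq_ordIso_trans[OF this S(1)] show ?thesis
      by (rule ordIso_ordLeq_trans[OF ordIso_symmetric[OF card_of_T_block[OF k[OF that]]]])
  qed
  then have "|X| \<le>o |S|"
    using sup card_of_Card_order[of S] unfolding is_card_Sup_def by blast
  then show False
    using S(2) not_ordLess_ordLeq by blast
qed

section \<open>Coarse equivalence with \<open>T\<close> in the two cases of the dichotomy\<close>

context Metric_space
begin

text \<open>The separate order \<open>r\<close> lets the same argument serve \<open>|X|\<close> and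
  \<open>natLeq\<close>, which live on different types.\<close>

lemma full_coarsely_equivalent_T:
  fixes r :: "'b rel"
  assumes inf: "infinite M" and h: "height_metric M d h" and full: "\<And>j. \<exists>m. |M| \<le>o |annulus h M j m|"
    and r: "Card_order r" "|M| =o r"
  shows "coarsely_equivalent M d (T_space (\<lambda>_. r)) T_dist"
proof (rule coarsely_equivalent_T[OF large_self h])
  have "r \<le>o |M|"
    using r(2) by (simp add: ordIso_iff_ordLeq)
  then have "|T_space (\<lambda>_. r)| \<le>o |M|"
    using inf r(1) by (intro card_of_T_le)
  from ordLeq_transitive[OF this] show "annulus_dominated fst (T_space (\<lambda>_. r)) h M"
    using full by (intro annulus_dominated_full) blast
  show "annulus_dominated h M fst (T_space (\<lambda>_. r))"
    using ordIso_ordLeq_trans[OF r(2) card_of_T_const_annulus[OF r(1)]]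
    by (intro annulus_dominated_full exI)
qed

text \<open>Both \<open>L\<close> and \<open>T_space k\<close> have the cardinality of
  \<open>M\<close> and smaller sublevels, so \<open>annulus_dominated_small\<close> applies in both
  directions.\<close>

lemma small_coarsely_equivalent_T:
  assumes inf: "infinite M" and L: "large L" "height_metric L d h" "|L| =o |M|"
    and less: "\<And>n. |sublevel h L n| <o |M|"
    and k: "\<And>n. n \<ge> 1 \<Longrightarrow> Card_order (k n)" "\<And>n. n \<ge> 1 \<Longrightarrow> k n <o |M|"
    and ge: "|M| \<le>o |T_space k|"
  shows "coarsely_equivalent M d (T_space k) T_dist"
proof (rule coarsely_equivalent_T[OF L(1,2)])
  have M_L: "|M| =o |L|"
    using L(3) by (rule ordIso_symmetric)
  have M_T: "|M| =o |T_space k|"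
    using ge card_of_T_le[OF inf k(1)] k(2) by (simp add: ordIso_iff_ordLeq ordLess_imp_ordLeq)
  have T: "|sublevel fst (T_space k) n| <o |M|" for n
    by (rule card_of_T_sublevel_less[OF inf k])
  have infL: "infinite L" and infT: "infinite (T_space k)"
    using inf card_of_ordIso_finite[OF M_L] card_of_ordIso_finite[OF M_T] by auto
  show "annulus_dominated h L fst (T_space k)"
    by (intro annulus_dominated_small infT ordLess_ordIso_trans[OF _ M_T] less T)
  show "annulus_dominated fst (T_space k) h L"
    by (intro annulus_dominated_small infL ordLess_ordIso_trans[OF _ M_L] less T)
qed

end

theorem theorem7:
  fixes X :: "'a set" and d :: "'a \<Rightarrow> 'a \<Rightarrow> real"
  assumes "Metric_space X d"
    and "\<forall>x\<in>X. \<forall>y\<in>X. d x y \<in> \<nat>"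
    and "\<not> Metric_space.mbounded X d X"
    and "Metric_space.thin X d"
    and "Metric_space.asden X d =o |X|"
  shows
    "( |X| =o natLeq \<longrightarrow>
        coarsely_equivalent X d (T_space (\<lambda>_. |{()}| )) T_dist \<or>
        coarsely_equivalent X d (T_space (\<lambda>_. natLeq)) T_dist) \<and>
     (natLeq <o cf |X| \<longrightarrow>
        coarsely_equivalent X d (T_space (\<lambda>_. |X| )) T_dist) \<and>
     (\<forall>k :: nat \<Rightarrow> 'c rel.
        natLeq <o |X| \<and> cf |X| =o natLeq \<and>
        (\<forall>n\<ge>1. Card_order (k n)) \<and> (\<forall>n\<ge>1. k n <o k (Suc n)) \<and> is_card_Sup k |X| \<longrightarrow>
          coarsely_equivalent X d (T_space k) T_dist \<or>
          coarsely_equivalent X d (T_space (\<lambda>_. |X| )) T_dist)"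
proof -
  interpret Metric_space X d
    by (rule assms(1))
  have inf: "infinite X"
    using assms(3) by (rule infinite_if_unbounded)
  from assms(3-5) show ?thesis
  proof (cases rule: thin_cases)
    case (full h)
    note T = full_coarsely_equivalent_T[OF inf full]
    have "coarsely_equivalent X d (T_space (\<lambda>_. |X| )) T_dist"
      by (rule T[OF card_of_Card_order card_of_refl])
    moreover have "coarsely_equivalent X d (T_space (\<lambda>_. natLeq)) T_dist" if "|X| =o natLeq"
      by (rule T[OF natLeq_Card_order that])
    ultimately show ?thesis
      by blast
  next
    case (small h L)
    note T = small_coarsely_equivalent_T[OF inf small]
    have XL: "|X| \<le>o |L|"
      using small(3) by (simp add: ordIso_iff_ordLeq)
    have "coarsely_equivalent X d (T_space (\<lambda>_. |{()}| )) T_dist" if "|X| =o natLeq"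
    proof (rule T)
      show "|{()}| <o |X|"
        using inf by (intro card_of_finite_ordLess) auto
      have "T_space (\<lambda>_. |{()}| ) = {1..} \<times> {()}"
        by (auto simp: T_space_def Field_card_of)
      then have "infinite (T_space (\<lambda>_. |{()}| ))"
        by (simp add: finite_cartesian_product_iff infinite_Ici)
      then have "natLeq \<le>o |T_space (\<lambda>_. |{()}| )|"
        using infinite_iff_natLeq_ordLeq by blast
      then show "|X| \<le>o |T_space (\<lambda>_. |{()}| )|"
        by (rule ordIso_ordLeq_trans[OF that])
    qed (rule card_of_Card_order)
    \<comment> \<open>In this case (ii) holds vacuously.\<close>
    moreover have "\<not> natLeq <o cf |X|"
      by (rule not_uncountable_cf_if_sublevels_less[OF inf XL small(4)])
    moreover have "coarsely_equivalent X d (T_space k) T_dist"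
      if k: "\<forall>n\<ge>1. Card_order (k n)" "\<forall>n\<ge>1. k n <o k (Suc n)" "is_card_Sup k |X|"
      for k :: "nat \<Rightarrow> 'c rel"
    proof (rule T)
      fix n :: nat assume n: "n \<ge> 1"
      show "Card_order (k n)"
        using k(1) n by blast
      \<comment> \<open>The supremum gives only a weak bound; the next term of the increasing
        sequence makes it strict.\<close>
      have "k (Suc n) \<le>o |X|"
        using k(3) unfolding is_card_Sup_def by simp
      then show "k n <o |X|"
        using k(2) n by (blast intro: ordLess_ordLeq_trans)
    next
      show "|X| \<le>o |T_space k|"
        using k(1,3) card_of_T_ge_Sup by blast
    qed
    ultimately show ?thesis
      by blast
  qed
qed

end
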